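(* Let $R=(r_{ij};i,j\in\mathbb{N})$ and $A=(a_{ij};i,j\in\mathbb{N})$ be stable and conservative $Q$-matrices on $\mathbb{N}$, and suppose that $A$ is bounded, i.e. $\sup_{i\in\mathbb{N}}(-a_{ii})<\infty$. Let $Q=R+A$. Then $Q$ is regular if and only if $R$ is regular.
   Context: $\mathbb{N}=\{0,1,2,\ldots\}$. A stable and conservative $Q$-matrix on $\mathbb{N}$ is a real matrix $(q_{ij};i,j\in\mathbb{N})$ with $q_{ij}\ge 0$ for $i\ne j$, $0\le -q_{ii}<\infty$ and $\sum_{j\in\mathbb{N}}q_{ij}=0$ for all $i$. The Feller minimal transition function $P(t)=\{P_{ij}(t);i,j\in\mathbb{N}\}$, $t\ge 0$, of a $Q$-matrix is the minimal nonnegative solution of its backward Kolmogorov equation $\frac{d}{dt}P_{ij}(t)=\sum_{k\in\mathbb{N}}q_{ik}P_{kj}(t)$ with $P_{ij}(0)=\delta_{ij}$. The $Q$-matrix is called regular if its Feller minimal transition function is honest, i.e. $\sum_{j=0}^\infty P_{ij}(t)=1$ for all $i\ge 0$ and $t\ge 0$. *)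

theory Defs
  imports Complex_Main
begin

text \<open>
  Matrices on the natural numbers are functions \<^typ>\<open>nat \<Rightarrow> nat \<Rightarrow> real\<close>, so all entries are
  finite. A matrix-valued function of time is \<^typ>\<open>real \<Rightarrow> nat \<Rightarrow> nat \<Rightarrow> real\<close>, with the entry
  \<open>P\<^sub>i\<^sub>j(t)\<close> written \<open>P t i j\<close>; only its values at times \<open>t \<ge> 0\<close> are meaningful.
\<close>

definition stable_conservative_Q_matrix :: "(nat \<Rightarrow> nat \<Rightarrow> real) \<Rightarrow> bool" where
  "stable_conservative_Q_matrix q \<longleftrightarrow>
     (\<forall>i j. i \<noteq> j \<longrightarrow> 0 \<le> q i j) \<and>
     (\<forall>i. 0 \<le> - q i i) \<and>
     (\<forall>i. (\<lambda>j. q i j) sums 0)"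

text \<open>
  The derivative is one-sided at \<open>t = 0\<close>. Convergence of the series is part of the equation, since
  \<^const>\<open>suminf\<close> is unspecified for divergent series.
\<close>

definition solves_backward_equation ::
    "(nat \<Rightarrow> nat \<Rightarrow> real) \<Rightarrow> (real \<Rightarrow> nat \<Rightarrow> nat \<Rightarrow> real) \<Rightarrow> bool" where
  "solves_backward_equation q P \<longleftrightarrow>
     (\<forall>i j. P 0 i j = (if i = j then 1 else 0)) \<and>
     (\<forall>t\<ge>0. \<forall>i j. summable (\<lambda>k. q i k * P t k j) \<and>
        ((\<lambda>s. P s i j) has_real_derivative (\<Sum>k. q i k * P t k j)) (at t within {0..}))"

definition nonneg_backward_solution ::
    "(nat \<Rightarrow> nat \<Rightarrow> real) \<Rightarrow> (real \<Rightarrow> nat \<Rightarrow> nat \<Rightarrow> real) \<Rightarrow> bool" where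
  "nonneg_backward_solution q P \<longleftrightarrow>
     (\<forall>t\<ge>0. \<forall>i j. 0 \<le> P t i j) \<and> solves_backward_equation q P"

definition feller_minimal ::
    "(nat \<Rightarrow> nat \<Rightarrow> real) \<Rightarrow> (real \<Rightarrow> nat \<Rightarrow> nat \<Rightarrow> real) \<Rightarrow> bool" where
  "feller_minimal q P \<longleftrightarrow>
     nonneg_backward_solution q P \<and>
     (\<forall>P'. nonneg_backward_solution q P' \<longrightarrow> (\<forall>t\<ge>0. \<forall>i j. P t i j \<le> P' t i j))"

text \<open>
  The minimal solution is determined at all times \<open>t \<ge> 0\<close>, so the existential quantifier in
  \<open>regular_Q_matrix\<close> below only names it.
\<close>

lemma feller_minimal_unique:
  assumes "feller_minimal q P" and "feller_minimal q P'" and "0 \<le> t"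
  shows "P t i j = P' t i j"
  using assms unfolding feller_minimal_def by (meson order_antisym)

definition honest :: "(real \<Rightarrow> nat \<Rightarrow> nat \<Rightarrow> real) \<Rightarrow> bool" where
  "honest P \<longleftrightarrow> (\<forall>t\<ge>0. \<forall>i. (\<lambda>j. P t i j) sums 1)"

definition regular_Q_matrix :: "(nat \<Rightarrow> nat \<Rightarrow> real) \<Rightarrow> bool" where
  "regular_Q_matrix q \<longleftrightarrow> (\<exists>P. feller_minimal q P \<and> honest P)"

end

theory Submission
  imports Defs "HOL-Analysis.Analysis"
begin

text \<open>
  Regularity is turned into a statement about a single vector inequality, in which a bounded
  perturbation can be absorbed by changing a constant. Call a vector \<open>z\<close> with \<open>0 \<le> z i \<le> 1\<close> an exit
  vector of \<open>q\<close> at rate \<open>lam\<close> if \<open>lam * z \<le> q z\<close>. For \<open>lam > 0\<close>, the matrix \<open>q\<close> is regular if and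
  only if its only exit vector at rate \<open>lam\<close> is zero. It is essential that this holds with every
  \<open>lam\<close>: regularity excludes nonzero exit vectors at all positive rates, whereas excluding them at
  one positive rate already gives regularity.

  Let \<open>- A i i \<le> c\<close>. A nonzero exit vector of \<open>R\<close> at rate \<open>1 + c\<close> is one of \<open>R + A\<close> at rate \<open>1\<close>,
  as \<open>A z \<ge> - c * z\<close> (\<open>exit_vector_add_bounded\<close>). Conversely, if \<open>z\<close> is an exit vector of \<open>R + A\<close>
  at rate \<open>1\<close> with supremum \<open>1\<close>, then \<open>A z \<le> c * (1 - z)\<close>, and the positive part of
  \<open>z - c / (1 + c)\<close> is a nonzero exit vector of \<open>R\<close> at rate \<open>1 + c\<close>
  (\<open>exit_vector_remove_bounded\<close>).

  The criterion itself compares the minimal solution with explicit functions. Given \<open>z\<close>, a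
  supersolution built from \<open>z\<close> forces the total mass to drop below one
  (\<open>regular_imp_exit_vector_zero\<close>). Given a loss of mass, its Laplace transform over a finite time
  interval is, up to scaling, a nonzero exit vector (\<open>exit_vector_zero_imp_regular\<close>). Both need the
  minimal solution in hand, so it is constructed by Feller's iteration: the iterates increase, lie
  below every nonnegative supersolution, and converge to a solution of the backward equation because
  each row of the equation bounds the time derivative (\<open>backward_equation_limit\<close>). The same limit
  argument shows that the total mass solves the backward equation.
\<close>

section \<open>Calculus on the half-line\<close>

lemma DERIV_within_half_line:
  fixes f :: "real \<Rightarrow> real"
  assumes "(f has_real_derivative D) (at t within {0..})" and "0 < t"
  shows "(f has_real_derivative D) (at t)"
proof -
  have "at t within {0..} = at t"
    using assms(2) by (intro at_within_interior) (simp add: interior_real_atLeast)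
  then show ?thesis using assms(1) by simp
qed

lemma DERIV_half_line_imp_continuous_on:
  fixes f :: "real \<Rightarrow> real"
  assumes "\<And>t. 0 \<le> t \<Longrightarrow> (f has_real_derivative f' t) (at t within {0..})"
  shows "continuous_on {0..} f"
  using assms by (intro DERIV_continuous_on) auto

lemma integral_DERIV_half_line:
  fixes g :: "real \<Rightarrow> real"
  assumes "continuous_on {0..} g" and "0 \<le> t"
  shows "((\<lambda>x. integral {0..x} g) has_real_derivative g t) (at t within {0..})"
proof -
  have "((\<lambda>x. integral {0..x} g) has_real_derivative g t) (at t within {0..t+1})"
    using assms by (intro integral_has_real_derivative continuous_on_subset[OF assms(1)]) auto
  moreover have "at t within {0..t+1} = at t within {0..}"
    by (rule at_within_nhd[of t "{..<t+1}"]) auto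
  ultimately show ?thesis by simp
qed

text \<open>
  The integrating factor \<open>exp (- c t)\<close> turns the linear differential inequality into monotonicity.
\<close>

lemma linear_differential_inequality_nonneg:
  fixes h :: "real \<Rightarrow> real"
  assumes der: "\<And>t. 0 \<le> t \<Longrightarrow> t \<le> T \<Longrightarrow> (h has_real_derivative h' t) (at t within {0..})"
    and ineq: "\<And>t. 0 \<le> t \<Longrightarrow> t \<le> T \<Longrightarrow> c * h t \<le> h' t"
    and init: "0 \<le> h 0" and t: "0 \<le> t" "t \<le> T"
  shows "0 \<le> h t"
proof -
  let ?g = "\<lambda>s. exp (- c * s) * h s"
  have g: "(?g has_real_derivative exp (- c * s) * (h' s - c * h s)) (at s within {0..})"
    if "0 \<le> s" "s \<le> T" for s
    by (rule derivative_eq_intros der that refl | simp add: algebra_simps)+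
  have "?g 0 \<le> ?g t"
  proof (rule DERIV_nonneg_imp_increasing_open[where f = ?g])
    show "\<exists>y. DERIV ?g s :> y \<and> 0 \<le> y" if "0 < s" "s < t" for s
      using DERIV_within_half_line[OF g] ineq[of s] that t
      by (intro exI[of _ "exp (- c * s) * (h' s - c * h s)"]) auto
    show "continuous_on {0..t} ?g"
      using t by (intro DERIV_continuous_on[OF DERIV_subset[OF g]]) auto
  qed (use t in auto)
  then have "0 \<le> ?g t" using init by simp
  then show ?thesis by (simp add: zero_le_mult_iff)
qed

text \<open>
  Passing to the limit under the integral sign replaces uniform convergence of the derivatives by a
  uniform bound; continuity of the limiting derivative then allows to differentiate again.
\<close>

lemma DERIV_limit_of_bounded:
  fixes \<phi> :: "nat \<Rightarrow> real \<Rightarrow> real"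
  assumes der: "\<And>n t. 0 \<le> t \<Longrightarrow> (\<phi> n has_real_derivative \<psi> n t) (at t within {0..})"
    and bound: "\<And>n t. 0 \<le> t \<Longrightarrow> \<bar>\<psi> n t\<bar> \<le> C"
    and \<phi>: "\<And>t. 0 \<le> t \<Longrightarrow> (\<lambda>n. \<phi> n t) \<longlonglongrightarrow> f t"
    and \<psi>: "\<And>t. 0 \<le> t \<Longrightarrow> (\<lambda>n. \<psi> n t) \<longlonglongrightarrow> f' t"
    and cont: "continuous_on {0..} f'" and t: "0 \<le> t"
  shows "(f has_real_derivative f' t) (at t within {0..})"
proof -
  have eq: "f s = f 0 + integral {0..s} f'" if s: "0 \<le> s" for s
  proof -
    have int: "(\<psi> n has_integral (\<phi> n s - \<phi> n 0)) {0..s}" for n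
      using s by (intro fundamental_theorem_of_calculus)
        (auto simp flip: has_real_derivative_iff_has_vector_derivative intro: DERIV_subset[OF der])
    have "(\<lambda>n. integral {0..s} (\<psi> n)) \<longlonglongrightarrow> integral {0..s} f'"
    proof (rule dominated_convergence(2))
      show "\<psi> n integrable_on {0..s}" for n using int by blast
      show "(\<lambda>_. C) integrable_on {0..s}" by (rule integrable_const_ivl)
    qed (use bound \<psi> in auto)
    moreover have "(\<lambda>n. integral {0..s} (\<psi> n)) \<longlonglongrightarrow> f s - f 0"
      using tendsto_diff[OF \<phi>[OF s] \<phi>[of 0]] integral_unique[OF int] by simp
    ultimately show ?thesis using LIMSEQ_unique by fastforce
  qed
  have "((\<lambda>s. f 0 + integral {0..s} f') has_real_derivative f' t) (at t within {0..})"
    using DERIV_add[OF DERIV_const integral_DERIV_half_line[OF cont t]] by simp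
  then show ?thesis
    by (rule has_field_derivative_transform_within[where d = 1]) (simp_all add: t eq[symmetric])
qed

section \<open>The action of a conservative matrix on bounded vectors\<close>

definition off_diagonal :: "(nat \<Rightarrow> nat \<Rightarrow> real) \<Rightarrow> nat \<Rightarrow> nat \<Rightarrow> real" where
  "off_diagonal q i k = (if k = i then 0 else q i k)"

definition inflow :: "(nat \<Rightarrow> nat \<Rightarrow> real) \<Rightarrow> (nat \<Rightarrow> real) \<Rightarrow> nat \<Rightarrow> real" where
  "inflow q x i = (\<Sum>k. off_diagonal q i k * x k)"

abbreviation prob_vector :: "(nat \<Rightarrow> real) \<Rightarrow> bool" where
  "prob_vector x \<equiv> \<forall>k. 0 \<le> x k \<and> x k \<le> 1"

lemma row_term_split:
  "q i k * x k = off_diagonal q i k * x k + (if k = i then q k k * x k else 0)"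
  by (simp add: off_diagonal_def)

lemma summable_row_iff:
  "summable (\<lambda>k. q i k * x k) \<longleftrightarrow> summable (\<lambda>k. off_diagonal q i k * x k)"
proof
  assume "summable (\<lambda>k. q i k * x k)"
  then have "summable (\<lambda>k. q i k * x k - (if k = i then q k k * x k else 0))"
    by (intro summable_diff summable_single)
  moreover have "(\<lambda>k. q i k * x k - (if k = i then q k k * x k else 0)) =
      (\<lambda>k. off_diagonal q i k * x k)"
    by (auto simp: off_diagonal_def)
  ultimately show "summable (\<lambda>k. off_diagonal q i k * x k)" by simp
next
  assume "summable (\<lambda>k. off_diagonal q i k * x k)"
  then have "summable (\<lambda>k. off_diagonal q i k * x k + (if k = i then q k k * x k else 0))"
    by (intro summable_add summable_single)
  then show "summable (\<lambda>k. q i k * x k)" by (simp only: row_term_split[symmetric])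
qed

lemma suminf_row:
  assumes "summable (\<lambda>k. off_diagonal q i k * x k)"
  shows "(\<Sum>k. q i k * x k) = q i i * x i + inflow q x i"
proof -
  have "(\<lambda>k. off_diagonal q i k * x k + (if k = i then q k k * x k else 0))
      sums (inflow q x i + q i i * x i)"
    unfolding inflow_def by (intro sums_add summable_sums assms sums_single)
  then show ?thesis by (simp only: row_term_split[symmetric] sums_iff add.commute)
qed

text \<open>
  For \<open>lam > 0\<close>, a nonzero exit vector is the obstruction to regularity. The inequality, as opposed
  to the eigenvalue equation \<open>q z = lam * z\<close> of the classical criterion, is what survives a
  perturbation and the passage to a positive part.
\<close>

definition exit_vector :: "(nat \<Rightarrow> nat \<Rightarrow> real) \<Rightarrow> real \<Rightarrow> (nat \<Rightarrow> real) \<Rightarrow> bool" where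
  "exit_vector q lam z \<longleftrightarrow> prob_vector z \<and> (\<forall>i. lam * z i \<le> (\<Sum>k. q i k * z k))"

locale conservative_matrix =
  fixes q :: "nat \<Rightarrow> nat \<Rightarrow> real"
  assumes Q_matrix: "stable_conservative_Q_matrix q"
begin

lemma off_diagonal_nonneg: "0 \<le> off_diagonal q i k"
  using Q_matrix by (simp add: off_diagonal_def stable_conservative_Q_matrix_def)

lemma diagonal_nonpos: "q i i \<le> 0"
  using Q_matrix by (simp add: stable_conservative_Q_matrix_def)

lemma off_diagonal_sums: "off_diagonal q i sums (- q i i)"
proof -
  have "(\<lambda>k. q i k - (if k = i then q k k else 0)) sums (0 - q i i)"
    using Q_matrix by (intro sums_diff sums_single) (simp add: stable_conservative_Q_matrix_def)
  moreover have "(\<lambda>k. q i k - (if k = i then q k k else 0)) = off_diagonal q i"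
    by (auto simp: off_diagonal_def)
  ultimately show ?thesis by simp
qed

lemma off_diagonal_mult_bounds:
  assumes "0 \<le> a" and "a \<le> 1"
  shows "0 \<le> off_diagonal q i k * a" and "off_diagonal q i k * a \<le> off_diagonal q i k"
  using assms off_diagonal_nonneg by (simp_all add: mult_left_le)

lemma summable_off_diagonal:
  assumes "prob_vector x"
  shows "summable (\<lambda>k. off_diagonal q i k * x k)"
proof (rule summable_comparison_test')
  show "summable (off_diagonal q i)" using off_diagonal_sums by (rule sums_summable)
  show "norm (off_diagonal q i k * x k) \<le> off_diagonal q i k" for k
    using off_diagonal_mult_bounds[of "x k" i k] assms by simp
qed

lemma summable_row: "prob_vector x \<Longrightarrow> summable (\<lambda>k. q i k * x k)"
  by (rule summable_row_iff[THEN iffD2, OF summable_off_diagonal])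

lemma suminf_row_prob_vector:
  "prob_vector x \<Longrightarrow> (\<Sum>k. q i k * x k) = q i i * x i + inflow q x i"
  by (intro suminf_row summable_off_diagonal)

lemma inflow_nonneg: "prob_vector x \<Longrightarrow> 0 \<le> inflow q x i"
  unfolding inflow_def
  by (intro suminf_nonneg summable_off_diagonal) (simp_all add: off_diagonal_nonneg)

lemma inflow_one: "inflow q (\<lambda>_. 1) i = - q i i"
  using off_diagonal_sums by (simp add: inflow_def sums_iff)

lemma inflow_mono:
  assumes "prob_vector x" and "summable (\<lambda>k. off_diagonal q i k * y k)" and "\<And>k. x k \<le> y k"
  shows "inflow q x i \<le> inflow q y i"
  unfolding inflow_def
proof (rule suminf_le)
  show "off_diagonal q i k * x k \<le> off_diagonal q i k * y k" for k
    by (rule mult_left_mono[OF assms(3) off_diagonal_nonneg])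
qed (rule summable_off_diagonal[OF assms(1)], rule assms(2))

lemma inflow_le:
  assumes "prob_vector x"
  shows "inflow q x i \<le> - q i i"
proof -
  have "inflow q x i \<le> inflow q (\<lambda>_. 1) i"
    by (rule inflow_mono[OF assms summable_off_diagonal]) (simp_all add: assms)
  then show ?thesis by (simp add: inflow_one)
qed

lemma inflow_tendsto:
  assumes "\<And>n. prob_vector (x n)" and "\<And>k. (\<lambda>n. x n k) \<longlonglongrightarrow> y k"
  shows "(\<lambda>n. inflow q (x n) i) \<longlonglongrightarrow> inflow q y i"
proof -
  have "\<forall>\<^sub>F (k, n) in sequentially \<times>\<^sub>F sequentially.
      norm (off_diagonal q i k * x n k) \<le> off_diagonal q i k"
    by (rule always_eventually) (use assms(1) off_diagonal_mult_bounds in fastforce)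
  then show ?thesis
    unfolding inflow_def
    by (intro tannerys_theorem[where M = "off_diagonal q i", THEN conjunct2, THEN conjunct2]
        tendsto_mult_left assms(2) sums_summable[OF off_diagonal_sums]) simp_all
qed

lemma continuous_on_inflow:
  assumes cont: "\<And>k. continuous_on {0..} (v k)"
    and bounds: "\<And>t. 0 \<le> t \<Longrightarrow> prob_vector (\<lambda>k. v k t)"
  shows "continuous_on {0..} (\<lambda>t::real. inflow q (\<lambda>k. v k t) i)"
  unfolding inflow_def
proof (rule uniform_limit_theorem)
  show "uniform_limit {0..} (\<lambda>n t. \<Sum>k<n. off_diagonal q i k * v k t)
      (\<lambda>t. \<Sum>k. off_diagonal q i k * v k t) sequentially"
  proof (rule Weierstrass_m_test)
    show "norm (off_diagonal q i k * v k t) \<le> off_diagonal q i k" if "t \<in> {0..}" for k t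
      using off_diagonal_mult_bounds[of "v k t" i k] bounds[of t] that by simp
    show "summable (off_diagonal q i)" using off_diagonal_sums by (rule sums_summable)
  qed
  show "\<forall>\<^sub>F n in sequentially. continuous_on {0..} (\<lambda>t. \<Sum>k<n. off_diagonal q i k * v k t)"
    by (intro always_eventually allI continuous_intros cont)
qed simp

section \<open>Limits of approximate solutions\<close>

lemma prob_vector_limit:
  assumes "\<And>n. prob_vector (x n)" and "\<And>k. (\<lambda>n. x n k) \<longlonglongrightarrow> y k"
  shows "prob_vector y"
proof (intro allI conjI)
  show "0 \<le> y k" for k by (rule LIMSEQ_le_const[OF assms(2)]) (simp add: assms(1))
  show "y k \<le> 1" for k by (rule LIMSEQ_le_const2[OF assms(2)]) (simp add: assms(1))
qed

lemma row_bound: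
  assumes "prob_vector x" and "0 \<le> a" and "a \<le> 1"
  shows "\<bar>q i i * a + inflow q x i\<bar> \<le> - q i i"
proof -
  have "q i i \<le> q i i * a" "q i i * a \<le> 0"
    using assms diagonal_nonpos[of i] mult_left_mono_neg[of a 1 "q i i"]
    by (simp_all add: mult_nonpos_nonneg)
  then show ?thesis using inflow_nonneg[OF assms(1), of i] inflow_le[OF assms(1), of i] by linarith
qed

text \<open>
  Row \<open>i\<close> of the equation has derivatives bounded by \<open>- q i i\<close>, so the approximations are Lipschitz
  in time with a constant that survives the limit. This gives the continuity of the limit, which in
  turn makes its inflow continuous. Two sequences are used because the iteration below has the
  previous iterate in the inflow.
\<close>

lemma backward_equation_limit:
  assumes der: "\<And>n i t. 0 \<le> t \<Longrightarrow>
        (x n i has_real_derivative q i i * x n i t + inflow q (\<lambda>k. y n k t) i) (at t within {0..})"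
    and x: "\<And>n t. 0 \<le> t \<Longrightarrow> prob_vector (\<lambda>k. x n k t)"
    and y: "\<And>n t. 0 \<le> t \<Longrightarrow> prob_vector (\<lambda>k. y n k t)"
    and x_lim: "\<And>k t. 0 \<le> t \<Longrightarrow> (\<lambda>n. x n k t) \<longlonglongrightarrow> u k t"
    and y_lim: "\<And>k t. 0 \<le> t \<Longrightarrow> (\<lambda>n. y n k t) \<longlonglongrightarrow> u k t"
    and t: "0 \<le> t"
  shows "(u i has_real_derivative q i i * u i t + inflow q (\<lambda>k. u k t) i) (at t within {0..})"
proof (rule DERIV_limit_of_bounded[OF der, where C = "- q i i"])
  have u: "prob_vector (\<lambda>k. u k t)" if "0 \<le> t" for t
    using prob_vector_limit[OF x[OF that] x_lim[OF that]] .
  have row_deriv_bound: "\<bar>q k k * x n k t + inflow q (\<lambda>j. y n j t) k\<bar> \<le> - q k k"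
    if "0 \<le> t" for n k t
    using x[OF that] by (intro row_bound y[OF that]) simp_all
  have "\<bar>u k s - u k t\<bar> \<le> (- q k k) * \<bar>s - t\<bar>" if st: "0 \<le> s" "0 \<le> t" for k s t
  proof (rule LIMSEQ_le_const2)
    show "(\<lambda>n. \<bar>x n k s - x n k t\<bar>) \<longlonglongrightarrow> \<bar>u k s - u k t\<bar>"
      using st by (intro tendsto_intros x_lim)
    have "norm (x n k s - x n k t) \<le> (- q k k) * norm (s - t)" for n
      by (rule field_differentiable_bound[OF _ der]) (simp_all add: st row_deriv_bound)
    then show "\<exists>N. \<forall>n\<ge>N. \<bar>x n k s - x n k t\<bar> \<le> (- q k k) * \<bar>s - t\<bar>" by auto
  qed
  then have "(- q k k)-lipschitz_on {0..} (u k)" for k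
    using diagonal_nonpos[of k] by (intro lipschitz_onI) (auto simp: dist_real_def)
  then have cont: "continuous_on {0..} (u k)" for k
    using lipschitz_on_continuous_on by blast
  show "continuous_on {0..} (\<lambda>t. q i i * u i t + inflow q (\<lambda>k. u k t) i)"
    by (intro continuous_intros continuous_on_inflow cont u)
  show "(\<lambda>n. q i i * x n i t + inflow q (\<lambda>k. y n k t) i)
      \<longlonglongrightarrow> q i i * u i t + inflow q (\<lambda>k. u k t) i" if "0 \<le> t" for t
    using that by (intro tendsto_intros inflow_tendsto x_lim y_lim y)
  show "\<bar>q i i * x n i s + inflow q (\<lambda>k. y n k s) i\<bar> \<le> - q i i" if "0 \<le> s" for n s
    by (rule row_deriv_bound[OF that])
qed (simp_all add: x_lim t)

section \<open>Construction of the minimal solution\<close>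

text \<open>
  Iteration of the variation-of-constants form of the backward equation with initial vector \<open>f\<close>,
  started at zero. For the indicator of \<open>{j}\<close>, iterate \<open>n\<close> is the probability of being in \<open>j\<close> at
  time \<open>t\<close> after fewer than \<open>n\<close> jumps.
\<close>

primrec feller_iterate :: "(nat \<Rightarrow> real) \<Rightarrow> nat \<Rightarrow> nat \<Rightarrow> real \<Rightarrow> real" where
  "feller_iterate f 0 i t = 0"
| "feller_iterate f (Suc n) i t = exp (q i i * t) *
     (f i + integral {0..t} (\<lambda>s. exp (- q i i * s) * inflow q (\<lambda>k. feller_iterate f n k s) i))"

lemma variation_of_constants_DERIV:
  fixes g :: "real \<Rightarrow> real"
  assumes "continuous_on {0..} g" and "0 \<le> t"
  shows "((\<lambda>t. exp (c * t) * (a + integral {0..t} (\<lambda>s. exp (- c * s) * g s))) has_real_derivative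
      c * (exp (c * t) * (a + integral {0..t} (\<lambda>s. exp (- c * s) * g s))) + g t) (at t within {0..})"
proof -
  have "continuous_on {0..} (\<lambda>s. exp (- c * s) * g s)"
    by (intro continuous_intros assms)
  note I = integral_DERIV_half_line[OF this assms(2)]
  have "exp (c * t) * exp (- c * t) = (1::real)" by (simp flip: exp_add)
  then have e: "exp (c * t) * (exp (- c * t) * g t) = g t" by (simp flip: mult.assoc)
  have "((\<lambda>t. exp (c * t) * (a + integral {0..t} (\<lambda>s. exp (- c * s) * g s))) has_real_derivative
      exp (c * t) * c * (a + integral {0..t} (\<lambda>s. exp (- c * s) * g s))
      + exp (c * t) * (exp (- c * t) * g t)) (at t within {0..})"
    by (rule derivative_eq_intros I refl | simp)+
  then show ?thesis unfolding e by (simp add: mult_ac)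
qed

lemma feller_iterate_Suc:
  "feller_iterate f (Suc n) i = (\<lambda>t. exp (q i i * t) *
     (f i + integral {0..t} (\<lambda>s. exp (- q i i * s) * inflow q (\<lambda>k. feller_iterate f n k s) i)))"
  by (rule ext) simp

lemma feller_iterate_aux:
  assumes f: "prob_vector f"
  shows "(\<forall>i. continuous_on {0..} (feller_iterate f n i)) \<and>
      (\<forall>t\<ge>0. prob_vector (\<lambda>i. feller_iterate f n i t))"
proof (induction n)
  case 0
  show ?case by (simp add: continuous_on_const)
next
  case (Suc n)
  have inflow_cont: "continuous_on {0..} (\<lambda>t. inflow q (\<lambda>k. feller_iterate f n k t) i)" for i
    using Suc.IH by (intro continuous_on_inflow) auto
  have der: "(feller_iterate f (Suc n) i has_real_derivative
      q i i * feller_iterate f (Suc n) i t + inflow q (\<lambda>k. feller_iterate f n k t) i) (at t within {0..})"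
    if "0 \<le> t" for i t
    unfolding feller_iterate_Suc by (rule variation_of_constants_DERIV[OF inflow_cont that])
  have "0 \<le> feller_iterate f (Suc n) i t" if "0 \<le> t" for i t
  proof (rule linear_differential_inequality_nonneg[where h = "feller_iterate f (Suc n) i" and t = t
        and c = "q i i" and T = t])
    show "(feller_iterate f (Suc n) i has_real_derivative
        q i i * feller_iterate f (Suc n) i s + inflow q (\<lambda>k. feller_iterate f n k s) i)
        (at s within {0..})" if "0 \<le> s" for s
      by (rule der[OF that])
    show "q i i * feller_iterate f (Suc n) i s
        \<le> q i i * feller_iterate f (Suc n) i s + inflow q (\<lambda>k. feller_iterate f n k s) i"
      if "0 \<le> s" for s
      using inflow_nonneg Suc.IH that by simp
  qed (use f that in auto)
  moreover have "0 \<le> 1 - feller_iterate f (Suc n) i t" if "0 \<le> t" for i t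
  proof (rule linear_differential_inequality_nonneg[where h = "\<lambda>s. 1 - feller_iterate f (Suc n) i s" and t = t
        and c = "q i i" and T = t])
    show "((\<lambda>s. 1 - feller_iterate f (Suc n) i s) has_real_derivative
        - (q i i * feller_iterate f (Suc n) i s + inflow q (\<lambda>k. feller_iterate f n k s) i))
        (at s within {0..})" if "0 \<le> s" for s
      using DERIV_diff[OF DERIV_const der[OF that]] by simp
    show "q i i * (1 - feller_iterate f (Suc n) i s)
        \<le> - (q i i * feller_iterate f (Suc n) i s + inflow q (\<lambda>k. feller_iterate f n k s) i)"
      if "0 \<le> s" for s
      using inflow_le[of "\<lambda>k. feller_iterate f n k s" i] Suc.IH that by (simp add: algebra_simps)
  qed (use f that in auto)
  ultimately show ?case
    using DERIV_half_line_imp_continuous_on[OF der] by (simp del: feller_iterate.simps)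
qed

context
  fixes f :: "nat \<Rightarrow> real"
  assumes f: "prob_vector f"
begin

lemma feller_iterate_bounds: "0 \<le> t \<Longrightarrow> prob_vector (\<lambda>i. feller_iterate f n i t)"
  using feller_iterate_aux[OF f] by blast

lemma continuous_on_feller_inflow:
  "continuous_on {0..} (\<lambda>t. inflow q (\<lambda>k. feller_iterate f n k t) i)"
  using feller_iterate_aux[OF f] by (intro continuous_on_inflow) auto

lemma feller_iterate_DERIV:
  assumes "0 \<le> t"
  shows "(feller_iterate f (Suc n) i has_real_derivative
      q i i * feller_iterate f (Suc n) i t + inflow q (\<lambda>k. feller_iterate f n k t) i) (at t within {0..})"
  unfolding feller_iterate_Suc
  by (rule variation_of_constants_DERIV[OF continuous_on_feller_inflow assms])

text \<open>
  The comparison principle behind minimality. A solution that competes with the minimal one may be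
  unbounded with a discontinuous derivative, so the comparison is made in differential form: the
  difference to the next iterate satisfies a linear differential inequality, since the iterate
  before it already lies below \<open>g\<close>.
\<close>

lemma feller_iterate_le_supersolution:
  assumes nonneg: "\<And>k t. 0 \<le> t \<Longrightarrow> t \<le> T \<Longrightarrow> 0 \<le> g k t"
    and der: "\<And>k t. 0 \<le> t \<Longrightarrow> t \<le> T \<Longrightarrow> (g k has_real_derivative g' k t) (at t within {0..})"
    and summable: "\<And>k t. 0 \<le> t \<Longrightarrow> t \<le> T \<Longrightarrow> summable (\<lambda>j. off_diagonal q k j * g j t)"
    and super: "\<And>k t. 0 \<le> t \<Longrightarrow> t \<le> T \<Longrightarrow> q k k * g k t + inflow q (\<lambda>j. g j t) k \<le> g' k t"
    and init: "\<And>k. f k \<le> g k 0"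
  shows "0 \<le> t \<Longrightarrow> t \<le> T \<Longrightarrow> feller_iterate f n i t \<le> g i t"
proof (induction n arbitrary: i t)
  case 0
  then show ?case using nonneg by simp
next
  case (Suc n)
  have "0 \<le> g i t - feller_iterate f (Suc n) i t"
  proof (rule linear_differential_inequality_nonneg[where h = "\<lambda>s. g i s - feller_iterate f (Suc n) i s" and t = t
        and c = "q i i" and T = T])
    show "((\<lambda>s. g i s - feller_iterate f (Suc n) i s) has_real_derivative
        g' i s - (q i i * feller_iterate f (Suc n) i s + inflow q (\<lambda>k. feller_iterate f n k s) i))
        (at s within {0..})" if "0 \<le> s" "s \<le> T" for s
      by (intro DERIV_diff der feller_iterate_DERIV that)
    show "q i i * (g i s - feller_iterate f (Suc n) i s) \<le>
        g' i s - (q i i * feller_iterate f (Suc n) i s + inflow q (\<lambda>k. feller_iterate f n k s) i)"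
      if s: "0 \<le> s" "s \<le> T" for s
    proof -
      have "inflow q (\<lambda>k. feller_iterate f n k s) i \<le> inflow q (\<lambda>k. g k s) i"
        using s by (intro inflow_mono feller_iterate_bounds summable Suc.IH)
      then show ?thesis using super[OF s, of i] by (simp only: algebra_simps)
    qed
  qed (use init Suc.prems in auto)
  then show ?case by linarith
qed

lemma feller_iterate_mono_step: "0 \<le> t \<Longrightarrow> feller_iterate f n i t \<le> feller_iterate f (Suc n) i t"
proof (induction n arbitrary: i t)
  case 0
  then show ?case using feller_iterate_bounds[of t "Suc 0"] by (simp del: feller_iterate.simps(2))
next
  case (Suc n)
  let ?v = "\<lambda>n k s. feller_iterate f n k s"
  have "0 \<le> ?v (Suc (Suc n)) i t - ?v (Suc n) i t"
  proof (rule linear_differential_inequality_nonneg[where h = "\<lambda>s. ?v (Suc (Suc n)) i s - ?v (Suc n) i s" and t = t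
        and c = "q i i" and T = t])
    show "((\<lambda>s. ?v (Suc (Suc n)) i s - ?v (Suc n) i s) has_real_derivative
        (q i i * ?v (Suc (Suc n)) i s + inflow q (\<lambda>k. ?v (Suc n) k s) i)
        - (q i i * ?v (Suc n) i s + inflow q (\<lambda>k. ?v n k s) i)) (at s within {0..})"
      if "0 \<le> s" for s
      by (intro DERIV_diff feller_iterate_DERIV that)
    show "q i i * (?v (Suc (Suc n)) i s - ?v (Suc n) i s) \<le>
        (q i i * ?v (Suc (Suc n)) i s + inflow q (\<lambda>k. ?v (Suc n) k s) i)
        - (q i i * ?v (Suc n) i s + inflow q (\<lambda>k. ?v n k s) i)"
      if s: "0 \<le> s" for s
    proof -
      have "inflow q (\<lambda>k. ?v n k s) i \<le> inflow q (\<lambda>k. ?v (Suc n) k s) i"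
        using s by (intro inflow_mono feller_iterate_bounds summable_off_diagonal Suc.IH)
      then show ?thesis by (simp only: algebra_simps)
    qed
  qed (use Suc.prems in auto)
  then show ?case by linarith
qed

end

definition feller_limit :: "(nat \<Rightarrow> real) \<Rightarrow> nat \<Rightarrow> real \<Rightarrow> real" where
  "feller_limit f i t = lim (\<lambda>n. feller_iterate f n i t)"

context
  fixes f :: "nat \<Rightarrow> real"
  assumes f: "prob_vector f"
begin

lemma feller_iterate_tendsto:
  assumes "0 \<le> t"
  shows "(\<lambda>n. feller_iterate f n i t) \<longlonglongrightarrow> feller_limit f i t"
proof -
  have "incseq (\<lambda>n. feller_iterate f n i t)"
    using feller_iterate_mono_step[OF f assms] by (rule incseq_SucI)
  moreover have "\<forall>n. feller_iterate f n i t \<le> 1"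
    using feller_iterate_bounds[OF f assms] by blast
  ultimately have "convergent (\<lambda>n. feller_iterate f n i t)"
    using incseq_convergent unfolding convergent_def by metis
  then show ?thesis by (simp add: convergent_LIMSEQ_iff feller_limit_def)
qed

lemma feller_limit_bounds:
  assumes "0 \<le> t"
  shows "prob_vector (\<lambda>i. feller_limit f i t)"
  by (rule prob_vector_limit[OF feller_iterate_bounds[OF f assms] feller_iterate_tendsto[OF assms]])

lemma feller_limit_init: "feller_limit f i 0 = f i"
proof -
  have "(\<lambda>n. feller_iterate f (Suc n) i 0) \<longlonglongrightarrow> feller_limit f i 0"
    using feller_iterate_tendsto[of 0 i] by (intro LIMSEQ_Suc) simp
  then show ?thesis by (simp add: LIMSEQ_const_iff)
qed

lemma feller_limit_DERIV:
  assumes "0 \<le> t"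
  shows "(feller_limit f i has_real_derivative
      q i i * feller_limit f i t + inflow q (\<lambda>k. feller_limit f k t) i) (at t within {0..})"
proof (rule backward_equation_limit[OF feller_iterate_DERIV[OF f]])
  show "(\<lambda>n. feller_iterate f (Suc n) k t) \<longlonglongrightarrow> feller_limit f k t" if "0 \<le> t" for k t
    by (rule LIMSEQ_Suc[OF feller_iterate_tendsto[OF that]])
qed (assumption | rule assms feller_iterate_bounds[OF f] feller_iterate_tendsto)+

lemma feller_limit_le_supersolution:
  assumes nonneg: "\<And>k t. 0 \<le> t \<Longrightarrow> t \<le> T \<Longrightarrow> 0 \<le> g k t"
    and der: "\<And>k t. 0 \<le> t \<Longrightarrow> t \<le> T \<Longrightarrow> (g k has_real_derivative g' k t) (at t within {0..})"
    and summable: "\<And>k t. 0 \<le> t \<Longrightarrow> t \<le> T \<Longrightarrow> summable (\<lambda>j. off_diagonal q k j * g j t)"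
    and super: "\<And>k t. 0 \<le> t \<Longrightarrow> t \<le> T \<Longrightarrow> q k k * g k t + inflow q (\<lambda>j. g j t) k \<le> g' k t"
    and init: "\<And>k. f k \<le> g k 0"
    and t: "0 \<le> t" "t \<le> T"
  shows "feller_limit f i t \<le> g i t"
proof (rule LIMSEQ_le_const2[OF feller_iterate_tendsto[OF t(1)]], intro exI allI impI)
  show "feller_iterate f n i t \<le> g i t" for n
    by (rule feller_iterate_le_supersolution[OF f, where T = T and g' = g']) (fact assms)+
qed

end

lemma feller_iterate_add:
  assumes f: "prob_vector f" and g: "prob_vector g"
  shows "0 \<le> t \<Longrightarrow> feller_iterate (\<lambda>k. f k + g k) n i t = feller_iterate f n i t + feller_iterate g n i t"
proof (induction n arbitrary: i t)
  case (Suc n)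
  let ?I = "\<lambda>f s. exp (- q i i * s) * inflow q (\<lambda>k. feller_iterate f n k s) i"
  have int: "?I h integrable_on {0..t}" if "prob_vector h" for h
    by (intro integrable_continuous_real continuous_intros
        continuous_on_subset[OF continuous_on_feller_inflow[OF that]]) auto
  have "integral {0..t} (?I (\<lambda>k. f k + g k)) = integral {0..t} (\<lambda>s. ?I f s + ?I g s)"
  proof (rule integral_cong)
    fix s assume "s \<in> {0..t}"
    then have s: "0 \<le> s" by simp
    have "inflow q (\<lambda>k. feller_iterate (\<lambda>k. f k + g k) n k s) i =
        inflow q (\<lambda>k. feller_iterate f n k s) i + inflow q (\<lambda>k. feller_iterate g n k s) i"
      unfolding inflow_def Suc.IH[OF s] ring_distribs
      by (intro suminf_add[symmetric] summable_off_diagonal feller_iterate_bounds f g s)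
    then show "?I (\<lambda>k. f k + g k) s = ?I f s + ?I g s" by (simp add: ring_distribs)
  qed
  also have "\<dots> = integral {0..t} (?I f) + integral {0..t} (?I g)"
    by (intro integral_add int f g)
  finally show ?case by (simp add: ring_distribs)
qed simp

text \<open>
  A finite sum of transition probabilities is again a minimal solution, and so inherits the bound by
  one and the comparison with supersolutions.
\<close>

lemma feller_limit_partial_sum:
  assumes "0 \<le> t"
  shows "feller_limit (indicator {..<m}) i t = (\<Sum>j<m. feller_limit (indicator {j}) i t)"
proof (induction m)
  case 0
  have "feller_iterate (\<lambda>_. 0) n i t = 0" for n i t
    by (induction n arbitrary: i t) (simp_all add: inflow_def)
  then show ?case by (simp add: feller_limit_def indicator_def)
next
  case (Suc m)
  have "indicator {..<Suc m} = (\<lambda>k. indicator {..<m} k + indicator {m} k :: real)"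
    by (auto simp: indicator_def fun_eq_iff)
  then have "feller_iterate (indicator {..<Suc m}) n i t =
      feller_iterate (indicator {..<m}) n i t + feller_iterate (indicator {m}) n i t" for n
    using feller_iterate_add[OF _ _ assms, of "indicator {..<m}" "indicator {m}" n i]
    by (simp add: indicator_def)
  moreover have "(\<lambda>n. feller_iterate (indicator {..<m}) n i t + feller_iterate (indicator {m}) n i t)
      \<longlonglongrightarrow> feller_limit (indicator {..<m}) i t + feller_limit (indicator {m}) i t"
    by (intro tendsto_add feller_iterate_tendsto assms) (simp_all add: indicator_def)
  ultimately have "feller_limit (indicator {..<Suc m}) i t =
      feller_limit (indicator {..<m}) i t + feller_limit (indicator {m}) i t"
    using feller_iterate_tendsto[of "indicator {..<Suc m}", OF _ assms, of i]
    by (auto simp: indicator_def intro: LIMSEQ_unique)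
  then show ?case using Suc.IH by simp
qed

definition minimal_transition :: "real \<Rightarrow> nat \<Rightarrow> nat \<Rightarrow> real" where
  "minimal_transition t i j = feller_limit (indicator {j}) i t"

lemma feller_minimal_minimal_transition: "feller_minimal q minimal_transition"
proof -
  have f: "prob_vector (indicator {j})" for j :: nat by (simp add: indicator_def)
  have "minimal_transition 0 i j = (if i = j then 1 else 0)" for i j
    by (simp add: minimal_transition_def feller_limit_init[OF f] indicator_def)
  moreover have "summable (\<lambda>k. q i k * minimal_transition t k j) \<and>
      ((\<lambda>s. minimal_transition s i j) has_real_derivative
        (\<Sum>k. q i k * minimal_transition t k j)) (at t within {0..})"
    if "0 \<le> t" for i j t
    using feller_limit_DERIV[OF f that, of j i] feller_limit_bounds[OF f that, of j]
    by (simp add: minimal_transition_def suminf_row_prob_vector summable_row)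
  ultimately have "nonneg_backward_solution q minimal_transition"
    using feller_limit_bounds[OF f]
    unfolding nonneg_backward_solution_def solves_backward_equation_def
    by (simp add: minimal_transition_def)
  moreover have "minimal_transition t i j \<le> P t i j"
    if P: "nonneg_backward_solution q P" and t: "0 \<le> t" for P t i j
    unfolding minimal_transition_def
  proof (rule feller_limit_le_supersolution[OF f, where T = t
        and g = "\<lambda>k s. P s k j" and g' = "\<lambda>k s. \<Sum>l. q k l * P s l j"])
    fix k and s :: real assume s: "0 \<le> s"
    show "0 \<le> P s k j" and
      "((\<lambda>s. P s k j) has_real_derivative (\<Sum>l. q k l * P s l j)) (at s within {0..})"
      using P s unfolding nonneg_backward_solution_def solves_backward_equation_def by auto
    show summable: "summable (\<lambda>l. off_diagonal q k l * P s l j)"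
      using P s unfolding nonneg_backward_solution_def solves_backward_equation_def
      by (simp flip: summable_row_iff)
    show "q k k * P s k j + inflow q (\<lambda>l. P s l j) k \<le> (\<Sum>l. q k l * P s l j)"
      using suminf_row[OF summable] by simp
  next
    show "indicator {j} k \<le> P 0 k j" for k
      using P unfolding nonneg_backward_solution_def solves_backward_equation_def
      by (simp add: indicator_def)
  qed (use t in auto)
  ultimately show ?thesis unfolding feller_minimal_def by blast
qed

lemma regular_iff_minimal_transition_honest: "regular_Q_matrix q \<longleftrightarrow> honest minimal_transition"
  using feller_minimal_unique[OF feller_minimal_minimal_transition] feller_minimal_minimal_transition
  unfolding regular_Q_matrix_def honest_def by (metis (no_types, lifting) sums_cong)

section \<open>Regularity and exit vectors\<close>

text \<open>
  For an exit vector \<open>z\<close> the function \<open>1 - z i * exp (lam * (t - T))\<close> is a nonnegative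
  supersolution on \<open>[0, T]\<close>. Normalised to start above \<open>1\<close>, it bounds the total mass at time \<open>T\<close>
  by \<open>(1 - z i) / (1 - exp (- lam * T))\<close>; if no mass is lost, \<open>z i \<le> exp (- lam * T)\<close> for all
  \<open>T\<close>.
\<close>

lemma regular_imp_exit_vector_zero:
  assumes regular: "regular_Q_matrix q" and lam: "0 < lam" and z: "exit_vector q lam z"
  shows "z i = 0"
proof -
  have zb: "0 \<le> z k" "z k \<le> 1" for k using z by (auto simp: exit_vector_def)
  have "z i \<le> exp (- lam * T)" if T: "0 < T" for T
  proof -
    \<comment> \<open>a lower bound for \<open>1 - z k * exp (- lam * T)\<close>, as \<open>z k \<le> 1\<close>\<close>
    define c where "c = 1 - exp (- lam * T)"
    have c: "0 < c" using T lam by (simp add: c_def)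
    have e1: "exp (lam * (s - T)) \<le> 1" if "s \<le> T" for s
      using that lam by (simp add: mult_nonneg_nonpos)
    let ?e = "\<lambda>s. exp (lam * (s - T))"
    have "(\<Sum>j<m. minimal_transition T i j) \<le> (1 - z i) / c" for m
    proof -
      have "feller_limit (indicator {..<m}) i T \<le> (1 - z i * ?e T) / c"
      proof (rule feller_limit_le_supersolution[where T = T and g = "\<lambda>k s. (1 - z k * ?e s) / c"
            and g' = "\<lambda>k s. - (z k * (lam * ?e s)) / c"])
        show "prob_vector (indicator {..<m})" by (simp add: indicator_def)
        fix k s assume s: "0 \<le> s" "s \<le> T"
        have ze: "z j * ?e s \<le> 1" "0 \<le> z j * ?e s" for j
          using zb[of j] e1[OF s(2)] by (auto intro: mult_le_one)
        then show "0 \<le> (1 - z k * ?e s) / c" using c by simp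
        show "((\<lambda>s. (1 - z k * ?e s) / c) has_real_derivative - (z k * (lam * ?e s)) / c)
            (at s within {0..})"
          by (rule derivative_eq_intros refl | use c in simp)+
        have summable: "summable (\<lambda>j. off_diagonal q k j * (1 - z j * ?e s))"
          using ze by (intro summable_off_diagonal) simp
        then show "summable (\<lambda>j. off_diagonal q k j * ((1 - z j * ?e s) / c))"
          using summable_divide[OF summable, of c] by simp
        have "inflow q (\<lambda>j. (1 - z j * ?e s) / c) k = inflow q (\<lambda>j. 1 - z j * ?e s) k / c"
          unfolding inflow_def using suminf_divide[OF summable, of c] by simp
        also have "inflow q (\<lambda>j. 1 - z j * ?e s) k = - q k k - ?e s * inflow q z k"
        proof -
          have "(\<lambda>j. off_diagonal q k j - ?e s * (off_diagonal q k j * z j))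
              sums (- q k k - ?e s * inflow q z k)"
            unfolding inflow_def using zb
            by (intro sums_diff sums_mult off_diagonal_sums summable_sums summable_off_diagonal) simp
          then show ?thesis by (simp add: inflow_def sums_iff algebra_simps)
        qed
        finally have "q k k * ((1 - z k * ?e s) / c) + inflow q (\<lambda>j. (1 - z j * ?e s) / c) k
            = - (?e s * (q k k * z k + inflow q z k)) / c"
          using c by (simp add: field_simps)
        also have "\<dots> \<le> - (?e s * (lam * z k)) / c"
        proof -
          have "lam * z k \<le> (\<Sum>j. q k j * z j)" using z by (simp add: exit_vector_def)
          then have "lam * z k \<le> q k k * z k + inflow q z k"
            using zb by (simp add: suminf_row_prob_vector)
          then show ?thesis using c by (intro divide_right_mono) auto
        qed
        finally show "q k k * ((1 - z k * ?e s) / c) + inflow q (\<lambda>j. (1 - z j * ?e s) / c) k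
            \<le> - (z k * (lam * ?e s)) / c"
          by (simp add: mult_ac)
      next
        fix k
        have "z k * exp (- lam * T) \<le> exp (- lam * T)" using zb[of k] by (simp add: mult_left_le_one_le)
        then have "1 \<le> (1 - z k * ?e 0) / c" using c by (simp add: c_def)
        moreover have "indicator {..<m} k \<le> (1::real)" by (simp add: indicator_def)
        ultimately show "indicator {..<m} k \<le> (1 - z k * ?e 0) / c" by linarith
      qed (use T in auto)
      then show ?thesis using feller_limit_partial_sum[of T m i] T by (simp add: minimal_transition_def)
    qed
    moreover have "(\<lambda>j. minimal_transition T i j) sums 1"
      using regular T by (simp add: regular_iff_minimal_transition_honest honest_def)
    ultimately have "1 \<le> (1 - z i) / c"
      unfolding sums_def by - (rule LIMSEQ_le_const2, assumption, blast)
    then show ?thesis using c by (simp add: c_def)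
  qed
  note decay = this
  show ?thesis
  proof (rule ccontr)
    assume "z i \<noteq> 0"
    then have pos: "0 < z i" using zb[of i] by simp
    \<comment> \<open>at this time \<open>exp (- lam * T) = z i / exp 1\<close>\<close>
    define T where "T = (1 - ln (z i)) / lam"
    have "ln (z i) \<le> 0" using pos zb(2)[of i] by simp
    then have "0 < T" using lam by (simp add: T_def)
    moreover have "- lam * T = ln (z i) - 1" using lam by (simp add: T_def)
    ultimately have "z i \<le> exp (ln (z i) - 1)" using decay by metis
    also have "\<dots> < exp (ln (z i))" by simp
    finally show False using pos by simp
  qed
qed

text \<open>
  The total mass is also the limit of the minimal solutions that start from the indicators of
  \<open>{..<m}\<close>; this makes the limit theorem applicable to it and replaces a termwise differentiation.
\<close>

definition total_mass :: "nat \<Rightarrow> real \<Rightarrow> real" where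
  "total_mass i t = (\<Sum>j. minimal_transition t i j)"

lemma minimal_transition_sums_total_mass:
  assumes "0 \<le> t"
  shows "(\<lambda>j. minimal_transition t i j) sums total_mass i t" and "prob_vector (\<lambda>i. total_mass i t)"
proof -
  have nonneg: "0 \<le> minimal_transition t i j" for i j
    using feller_limit_bounds[of "indicator {j}", OF _ assms]
    by (simp add: minimal_transition_def indicator_def)
  have le: "(\<Sum>j<m. minimal_transition t i j) \<le> 1" for i m
    using feller_limit_bounds[of "indicator {..<m}", OF _ assms]
    by (simp add: minimal_transition_def indicator_def flip: feller_limit_partial_sum[OF assms])
  have sums: "(\<lambda>j. minimal_transition t i j) sums total_mass i t" for i
    unfolding total_mass_def using nonneg le
    by (intro summable_sums summableI_nonneg_bounded[where x = 1]) auto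
  then show "(\<lambda>j. minimal_transition t i j) sums total_mass i t" .
  show "prob_vector (\<lambda>i. total_mass i t)"
    using sums nonneg le unfolding total_mass_def sums_iff
    by (auto intro!: suminf_nonneg suminf_le_const)
qed

lemma total_mass_DERIV:
  assumes "0 \<le> t"
  shows "(total_mass i has_real_derivative
      q i i * total_mass i t + inflow q (\<lambda>k. total_mass k t) i) (at t within {0..})"
proof (rule backward_equation_limit)
  fix m k and s :: real assume s: "0 \<le> s"
  have f: "prob_vector (indicator {..<m})" by (simp add: indicator_def)
  show "(feller_limit (indicator {..<m}) k has_real_derivative
      q k k * feller_limit (indicator {..<m}) k s + inflow q (\<lambda>j. feller_limit (indicator {..<m}) j s) k)
      (at s within {0..})"
    by (rule feller_limit_DERIV[OF f s])
  show "prob_vector (\<lambda>k. feller_limit (indicator {..<m}) k s)"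
    by (rule feller_limit_bounds[OF f s])
  then show "prob_vector (\<lambda>k. feller_limit (indicator {..<m}) k s)" .
next
  fix k and s :: real assume s: "0 \<le> s"
  show "(\<lambda>m. feller_limit (indicator {..<m}) k s) \<longlonglongrightarrow> total_mass k s"
    using minimal_transition_sums_total_mass(1)[OF s]
    by (simp add: feller_limit_partial_sum[OF s] sums_def flip: minimal_transition_def)
  then show "(\<lambda>m. feller_limit (indicator {..<m}) k s) \<longlonglongrightarrow> total_mass k s" .
qed (rule assms)

text \<open>
  The lost mass \<open>d = 1 - total_mass\<close> solves \<open>d' = q d\<close> with \<open>d 0 = 0\<close>. Integrating
  \<open>exp (- lam * t) * d\<close> by parts over \<open>[0, T]\<close> shows that its truncated Laplace transform \<open>z\<close>
  satisfies \<open>q z - lam * z = exp (- lam * T) * d T \<ge> 0\<close>, so \<open>z / T\<close> is an exit vector. If it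
  vanishes for every \<open>T\<close>, then so does \<open>d\<close>.
\<close>

lemma exit_vector_zero_imp_regular:
  assumes lam: "0 < lam" and zero: "\<And>z i. exit_vector q lam z \<Longrightarrow> z i = 0"
  shows "regular_Q_matrix q"
proof -
  define d where "d i t = 1 - total_mass i t" for i t
  have d01: "prob_vector (\<lambda>i. d i t)" if "0 \<le> t" for t
    using minimal_transition_sums_total_mass(2)[OF that] by (simp add: d_def)
  have d_inflow: "inflow q (\<lambda>k. d k t) i = - q i i - inflow q (\<lambda>k. total_mass k t) i"
    if "0 \<le> t" for i t
  proof -
    have "(\<lambda>k. off_diagonal q i k - off_diagonal q i k * total_mass k t)
        sums (- q i i - inflow q (\<lambda>k. total_mass k t) i)"
      unfolding inflow_def
      by (intro sums_diff off_diagonal_sums summable_sums summable_off_diagonal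
          minimal_transition_sums_total_mass(2) that)
    then show ?thesis by (simp add: inflow_def d_def sums_iff algebra_simps)
  qed
  have d_der: "(d i has_real_derivative q i i * d i t + inflow q (\<lambda>k. d k t) i) (at t within {0..})"
    if "0 \<le> t" for i t
    unfolding d_inflow[OF that]
    using DERIV_diff[OF DERIV_const total_mass_DERIV[OF that, of i], of 1]
    by (simp add: d_def[abs_def] algebra_simps)
  have d_cont: "continuous_on {0..} (d i)" for i
    by (rule DERIV_half_line_imp_continuous_on[OF d_der])
  have d0: "d i 0 = 0" for i
  proof -
    have "minimal_transition 0 i = (\<lambda>j. if j = i then 1 else 0)"
      by (rule ext) (auto simp: minimal_transition_def feller_limit_init indicator_def)
    then have "total_mass i 0 = 1"
      using sums_single[of i "\<lambda>_. 1 :: real"] by (simp add: total_mass_def sums_iff)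
    then show ?thesis by (simp add: d_def)
  qed
  have "d i T = 0" if T: "0 < T" for i T
  proof -
    let ?e = "\<lambda>t. exp (- lam * t)"
    define Z where "Z k = integral {0..T} (\<lambda>t. ?e t * d k t)" for k
    have ed: "0 \<le> ?e t * d k t" "?e t * d k t \<le> 1" if "0 \<le> t" for k t
      using d01[OF that] lam that by (auto intro: mult_le_one)
    have ed_cont: "continuous_on {0..T} (\<lambda>t. ?e t * d k t)" for k
      by (intro continuous_intros continuous_on_subset[OF d_cont]) auto
    have ed_int: "(\<lambda>t. ?e t * d k t) integrable_on {0..T}" for k
      by (rule integrable_continuous_real[OF ed_cont])
    have Z0: "0 \<le> Z k" for k
      unfolding Z_def using ed by (intro integral_nonneg ed_int) auto
    have ZT: "Z k \<le> T" for k
    proof -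
      have "Z k \<le> integral {0..T} (\<lambda>_. 1)"
        unfolding Z_def using ed by (intro integral_le ed_int integrable_const_ivl) auto
      then show ?thesis using T by simp
    qed
    have Z_T: "prob_vector (\<lambda>k. Z k / T)" using Z0 ZT T by simp
    have Z_inflow: "inflow q Z i = integral {0..T} (\<lambda>t. ?e t * inflow q (\<lambda>k. d k t) i)" for i
    proof -
      let ?s = "\<lambda>n t. \<Sum>k<n. off_diagonal q i k * (?e t * d k t)"
      have ed_summable: "summable (\<lambda>k. off_diagonal q i k * (?e t * d k t))" if "0 \<le> t" for t
        using ed[OF that] by (intro summable_off_diagonal) auto
      have e_inflow: "(\<Sum>k. off_diagonal q i k * (?e t * d k t)) = ?e t * inflow q (\<lambda>k. d k t) i"
        if "0 \<le> t" for t
        using suminf_mult[OF summable_off_diagonal[OF d01[OF that], of i], of "?e t"]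
        by (simp add: inflow_def mult_ac)
      have "(\<lambda>n. integral {0..T} (?s n)) \<longlonglongrightarrow> integral {0..T} (\<lambda>t. ?e t * inflow q (\<lambda>k. d k t) i)"
      proof (rule dominated_convergence(2))
        show "?s n integrable_on {0..T}" for n
          by (intro integrable_sum integrable_on_mult_right ed_int) auto
        show "(\<lambda>_. - q i i) integrable_on {0..T}" by (rule integrable_const_ivl)
        fix t assume "t \<in> {0..T}"
        then have t: "0 \<le> t" by simp
        show "(\<lambda>n. ?s n t) \<longlonglongrightarrow> ?e t * inflow q (\<lambda>k. d k t) i"
          using summable_LIMSEQ[OF ed_summable[OF t]] e_inflow[OF t] by simp
        show "norm (?s n t) \<le> - q i i" for n
        proof -
          have "?s n t \<le> (\<Sum>k. off_diagonal q i k * (?e t * d k t))"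
            using ed[OF t] off_diagonal_nonneg by (intro sum_le_suminf ed_summable t) auto
          also have "\<dots> \<le> - q i i"
            using inflow_le[of "\<lambda>k. ?e t * d k t" i] ed[OF t] by (simp add: inflow_def)
          finally show ?thesis
            using ed[OF t] off_diagonal_nonneg by (simp add: sum_nonneg)
        qed
      qed
      moreover have "integral {0..T} (?s n) = (\<Sum>k<n. off_diagonal q i k * Z k)" for n
        unfolding Z_def integral_mult_right[symmetric]
        by (intro integral_sum integrable_on_mult_right ed_int) simp
      ultimately have "(\<lambda>k. off_diagonal q i k * Z k)
          sums integral {0..T} (\<lambda>t. ?e t * inflow q (\<lambda>k. d k t) i)"
        by (simp add: sums_def)
      then show ?thesis by (simp add: inflow_def sums_iff)
    qed
    have "lam * (Z i / T) \<le> (\<Sum>k. q i k * (Z k / T))" for i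
    proof -
      let ?D = "\<lambda>t. (q i i - lam) * (?e t * d i t) + ?e t * inflow q (\<lambda>k. d k t) i"
      have "((\<lambda>t. ?e t * d i t) has_real_derivative ?D t) (at t within {0..T})" if "t \<in> {0..T}" for t
      proof -
        have e_der: "(?e has_real_derivative - lam * ?e t) (at t within {0..})"
          by (auto intro!: derivative_eq_intros)
        have "((\<lambda>t. ?e t * d i t) has_real_derivative ?D t) (at t within {0..})"
          using DERIV_mult[OF e_der d_der[of t i]] that by (simp add: algebra_simps)
        then show ?thesis by (rule DERIV_subset) auto
      qed
      then have "(?D has_integral (?e T * d i T - ?e 0 * d i 0)) {0..T}"
        using T by (intro fundamental_theorem_of_calculus)
          (auto simp flip: has_real_derivative_iff_has_vector_derivative)
      then have "integral {0..T} ?D = ?e T * d i T"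
        by (simp add: d0 integral_unique)
      moreover have "continuous_on {0..T} (\<lambda>t. ?e t * inflow q (\<lambda>k. d k t) i)"
        by (intro continuous_intros continuous_on_subset[OF continuous_on_inflow] d_cont d01) auto
      then have "(\<lambda>t. ?e t * inflow q (\<lambda>k. d k t) i) integrable_on {0..T}"
        by (rule integrable_continuous_real)
      then have "integral {0..T} ?D = (q i i - lam) * Z i + inflow q Z i"
        unfolding Z_inflow Z_def integral_mult_right[symmetric]
        by (intro integral_add integrable_on_mult_right ed_int)
      ultimately have "lam * Z i \<le> q i i * Z i + inflow q Z i"
        using ed(1)[of T i] T by (simp add: algebra_simps)
      moreover have "inflow q (\<lambda>k. Z k / T) i = inflow q Z i / T"
      proof -
        have "summable (\<lambda>k. off_diagonal q i k * Z k)"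
          using summable_mult[OF summable_off_diagonal[OF Z_T, of i], of T] T by simp
        then show ?thesis using suminf_divide[of _ T] by (simp add: inflow_def)
      qed
      ultimately show ?thesis
        using suminf_row_prob_vector[OF Z_T, of i] T by (simp add: divide_simps)
    qed
    then have "exit_vector q lam (\<lambda>k. Z k / T)" using Z_T by (simp add: exit_vector_def)
    then have "Z i / T = 0" by (rule zero)
    then have "integral {0..T} (\<lambda>t. ?e t * d i t) = 0" using T by (simp add: Z_def)
    then have "\<forall>t\<in>{0..T}. ?e t * d i t = 0"
      using integral_eq_0_iff[OF ed_cont T] ed by auto
    then show ?thesis using T by auto
  qed
  then have "d i t = 0" if "0 \<le> t" for i t
    using d0 that by (cases "t = 0") auto
  then have "honest minimal_transition"
    using minimal_transition_sums_total_mass(1) by (simp add: honest_def d_def)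
  then show ?thesis by (simp add: regular_iff_minimal_transition_honest)
qed

end

section \<open>Bounded perturbations\<close>

text \<open>
  Subtracting \<open>A\<close> costs at most its diagonal bound \<open>c\<close>, because the off-diagonal part of \<open>A\<close> only
  increases the action on a nonnegative vector.
\<close>

lemma exit_vector_add_bounded:
  assumes R: "stable_conservative_Q_matrix R" and A: "stable_conservative_Q_matrix A"
    and c: "\<And>i. - A i i \<le> c" and z: "exit_vector R lam z"
  shows "exit_vector (\<lambda>i j. R i j + A i j) (lam - c) z"
proof -
  interpret R: conservative_matrix R by unfold_locales (rule R)
  interpret A: conservative_matrix A by unfold_locales (rule A)
  have zb: "prob_vector z" using z by (simp add: exit_vector_def)
  have "(lam - c) * z i \<le> (\<Sum>k. (R i k + A i k) * z k)" for i
  proof -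
    have "(\<Sum>k. (R i k + A i k) * z k) = (\<Sum>k. R i k * z k) + (\<Sum>k. A i k * z k)"
      unfolding ring_distribs by (rule suminf_add[symmetric]) (intro R.summable_row A.summable_row zb)+
    moreover have "- c * z i \<le> A i i * z i"
      using c[of i] zb by (intro mult_right_mono) auto
    moreover have "lam * z i \<le> (\<Sum>k. R i k * z k)" using z by (simp add: exit_vector_def)
    ultimately show ?thesis
      using A.suminf_row_prob_vector[OF zb, of i] A.inflow_nonneg[OF zb, of i]
      by (simp add: algebra_simps)
  qed
  then show ?thesis using zb by (simp add: exit_vector_def)
qed

text \<open>
  Normalise \<open>z\<close> to supremum \<open>1\<close>. Since the rows of \<open>A\<close> sum to zero,
  \<open>A z \<le> c * (1 - z)\<close>, hence \<open>R z \<ge> (lam + c) * (z - \<theta>)\<close> with \<open>\<theta> = c / (lam + c) < 1\<close>. As \<open>R\<close>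
  annihilates constants and has nonnegative entries off the diagonal, the positive part of
  \<open>z - \<theta>\<close> is an exit vector of \<open>R\<close>; it is nonzero because \<open>z\<close> comes arbitrarily close to \<open>1\<close>.
\<close>

lemma exit_vector_remove_bounded:
  assumes R: "stable_conservative_Q_matrix R" and A: "stable_conservative_Q_matrix A"
    and c: "\<And>i. - A i i \<le> c" and lam: "0 < lam"
    and z: "exit_vector (\<lambda>i j. R i j + A i j) lam z" and nonzero: "z i0 \<noteq> 0"
  obtains w i where "exit_vector R (lam + c) w" and "w i \<noteq> 0"
proof -
  interpret R: conservative_matrix R by unfold_locales (rule R)
  interpret A: conservative_matrix A by unfold_locales (rule A)
  have c0: "0 \<le> c" using c[of 0] A.diagonal_nonpos[of 0] by linarith
  have zb: "prob_vector z" using z by (simp add: exit_vector_def)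
  have bdd: "bdd_above (range z)" using zb by (intro bdd_aboveI[of _ 1]) auto
  define M where "M = (SUP i. z i)"
  have zM: "z i \<le> M" for i unfolding M_def by (rule cSUP_upper[OF UNIV_I bdd])
  have "0 < z i0" using zb nonzero by (simp add: order.strict_iff_order)
  then have M: "0 < M" using zM[of i0] by linarith
  define y where "y i = z i / M" for i
  have yb: "prob_vector y" using zb zM M by (simp add: y_def)
  define \<theta> where "\<theta> = c / (lam + c)"
  have \<theta>: "0 \<le> \<theta>" "\<theta> < 1" using c0 lam by (simp_all add: \<theta>_def)
  have row: "(lam + c) * (y i - \<theta>) \<le> (\<Sum>k. R i k * y k)" for i
  proof -
    have "lam * y i \<le> (\<Sum>k. (R i k + A i k) * y k)"
    proof -
      have "summable (\<lambda>k. (R i k + A i k) * z k)"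
        unfolding ring_distribs by (intro summable_add R.summable_row A.summable_row zb)
      then have "(\<Sum>k. (R i k + A i k) * y k) = (\<Sum>k. (R i k + A i k) * z k) / M"
        using suminf_divide[of _ M] by (simp add: y_def)
      then show ?thesis using z M by (simp add: exit_vector_def y_def divide_right_mono)
    qed
    also have "\<dots> = (\<Sum>k. R i k * y k) + (\<Sum>k. A i k * y k)"
      unfolding ring_distribs by (rule suminf_add[symmetric]) (intro R.summable_row A.summable_row yb)+
    also have "(\<Sum>k. A i k * y k) \<le> A i i * y i + - A i i"
      unfolding A.suminf_row_prob_vector[OF yb] using A.inflow_le[OF yb] by (intro add_left_mono)
    also have "A i i * y i + - A i i \<le> c * (1 - y i)"
      using mult_right_mono[OF c[of i], of "1 - y i"] yb by (simp add: algebra_simps)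
    finally have "lam * y i - c * (1 - y i) \<le> (\<Sum>k. R i k * y k)" by simp
    moreover have "(lam + c) * \<theta> = c" using lam c0 by (simp add: \<theta>_def)
    ultimately show ?thesis by (simp add: algebra_simps)
  qed
  define w where "w i = max 0 (y i - \<theta>)" for i
  have wb: "prob_vector w"
  proof
    show "0 \<le> w k \<and> w k \<le> 1" for k using yb[rule_format, of k] \<theta>(1) by (simp add: w_def)
  qed
  have "(lam + c) * w i \<le> (\<Sum>k. R i k * w k)" for i
  proof (cases "y i \<le> \<theta>")
    case True
    then have "w i = 0" by (simp add: w_def)
    then show ?thesis
      using R.suminf_row_prob_vector[OF wb, of i] R.inflow_nonneg[OF wb, of i] by simp
  next
    case False
    then have wi: "w i = y i - \<theta>" by (simp add: w_def)
    have "(\<lambda>k. off_diagonal R i k * y k - off_diagonal R i k * \<theta>)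
        sums (inflow R y i - (- R i i) * \<theta>)"
      unfolding inflow_def
      by (intro sums_diff sums_mult2 R.off_diagonal_sums summable_sums R.summable_off_diagonal yb)
    then have shift: "(\<lambda>k. off_diagonal R i k * (y k - \<theta>)) sums (inflow R y i + R i i * \<theta>)"
      by (simp add: algebra_simps)
    have "inflow R y i + R i i * \<theta> \<le> inflow R w i"
    proof (unfold inflow_def, rule sums_le[OF _ shift[unfolded inflow_def]])
      show "off_diagonal R i k * (y k - \<theta>) \<le> off_diagonal R i k * w k" for k
        by (intro mult_left_mono R.off_diagonal_nonneg) (simp add: w_def)
      show "(\<lambda>k. off_diagonal R i k * w k) sums (\<Sum>k. off_diagonal R i k * w k)"
        by (intro summable_sums R.summable_off_diagonal wb)
    qed
    then show ?thesis
      using row[of i] R.suminf_row_prob_vector[OF wb, of i] R.suminf_row_prob_vector[OF yb, of i]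
      by (simp add: wi algebra_simps)
  qed
  then have "exit_vector R (lam + c) w" using wb by (simp add: exit_vector_def)
  moreover obtain i where "w i \<noteq> 0"
  proof -
    have "\<theta> * M < M" using \<theta>(2) M by simp
    then obtain i where "\<theta> * M < z i"
      using less_cSUP_iff[OF _ bdd] unfolding M_def by auto
    then have "\<theta> < y i" using M by (simp add: y_def field_simps)
    then show thesis using that[of i] by (simp add: w_def)
  qed
  ultimately show thesis using that by blast
qed

theorem theorem1p1:
  fixes R A Q :: "nat \<Rightarrow> nat \<Rightarrow> real"
  assumes "stable_conservative_Q_matrix R"
    and "stable_conservative_Q_matrix A"
    and "bdd_above (range (\<lambda>i. - A i i))"
    and "Q = (\<lambda>i j. R i j + A i j)"
  shows "regular_Q_matrix Q \<longleftrightarrow> regular_Q_matrix R"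
proof -
  have "stable_conservative_Q_matrix Q"
    unfolding assms(4) stable_conservative_Q_matrix_def
  proof (intro conjI allI impI)
    show "0 \<le> R i j + A i j" if "i \<noteq> j" for i j
      using assms(1,2) that by (simp add: stable_conservative_Q_matrix_def)
    show "0 \<le> - (R i i + A i i)" for i
      using assms(1,2) add_nonpos_nonpos[of "R i i" "A i i"]
      by (simp add: stable_conservative_Q_matrix_def)
    show "(\<lambda>j. R i j + A i j) sums 0" for i
      using assms(1,2) sums_add[of "R i" 0 "A i" 0] by (simp add: stable_conservative_Q_matrix_def)
  qed
  then interpret Q: conservative_matrix Q by unfold_locales
  interpret R: conservative_matrix R by unfold_locales (rule assms(1))
  interpret A: conservative_matrix A by unfold_locales (rule assms(2))
  obtain c where c: "- A i i \<le> c" for i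
    using assms(3) by (auto simp: bdd_above_def)
  have c0: "0 \<le> c" using c[of 0] A.diagonal_nonpos[of 0] by linarith
  show ?thesis
  proof
    assume regular: "regular_Q_matrix Q"
    show "regular_Q_matrix R"
    proof (rule R.exit_vector_zero_imp_regular)
      show "0 < 1 + c" using c0 by simp
      show "z i = 0" if "exit_vector R (1 + c) z" for z i
      proof (rule Q.regular_imp_exit_vector_zero[OF regular zero_less_one])
        show "exit_vector Q 1 z"
          using exit_vector_add_bounded[OF assms(1,2) c that] by (simp flip: assms(4))
      qed
    qed
  next
    assume regular: "regular_Q_matrix R"
    show "regular_Q_matrix Q"
    proof (rule Q.exit_vector_zero_imp_regular)
      show "z i = 0" if "exit_vector Q 1 z" for z i
      proof (rule ccontr)
        assume nonzero: "z i \<noteq> 0"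
        have z: "exit_vector (\<lambda>i j. R i j + A i j) 1 z"
          using that by (simp add: assms(4))
        obtain w k where w: "exit_vector R (1 + c) w" "w k \<noteq> 0"
          by (rule exit_vector_remove_bounded[OF assms(1,2) c zero_less_one z nonzero])
        have "0 < 1 + c" using c0 by simp
        then show False using R.regular_imp_exit_vector_zero[OF regular _ w(1)] w(2) by blast
      qed
    qed simp
  qed
qed

end
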